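(* Let $k\ge 1$ be an integer. If $G$ is a semi-bar $k$-visibility graph, then its thickness satisfies $\Theta(G)\le 2k$.
   Context: The thickness $\Theta(G)$ of a finite simple graph $G$ is the minimum number of planar subgraphs of $G$ whose union is $G$. A bar $k$-visibility representation of a graph is a finite set of pairwise disjoint closed horizontal segments (bars) in the plane, in bijection with the vertices, such that two distinct vertices $u,v$ are adjacent if and only if there is a vertical segment that intersects the bars of $u$ and $v$ and at most $k$ other bars. A semi-bar $k$-visibility graph is a graph having a bar $k$-visibility representation in which the left endpoints of all bars (then called semi-bars) have $x$-coordinate $0$. *)

theory Defs
  imports "HOL-Analysis.Analysis"
begin

definition simple_graph :: "'a set \<Rightarrow> 'a set set \<Rightarrow> bool" where
  "simple_graph V E \<longleftrightarrow> (\<forall>e\<in>E. e \<subseteq> V \<and> card e = 2)"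

definition finite_simple_graph :: "'a set \<Rightarrow> 'a set set \<Rightarrow> bool" where
  "finite_simple_graph V E \<longleftrightarrow> finite V \<and> simple_graph V E"

definition subgraph :: "'a set \<Rightarrow> 'a set set \<Rightarrow> 'a set \<Rightarrow> 'a set set \<Rightarrow> bool" where
  "subgraph W F V E \<longleftrightarrow> simple_graph W F \<and> W \<subseteq> V \<and> F \<subseteq> E"

definition planar_drawing ::
  "'a set \<Rightarrow> 'a set set \<Rightarrow> ('a \<Rightarrow> real \<times> real) \<Rightarrow> ('a set \<Rightarrow> real \<Rightarrow> real \<times> real) \<Rightarrow> bool" where
  "planar_drawing V E p \<gamma> \<longleftrightarrow>
     inj_on p V \<and>
     (\<forall>e\<in>E. arc (\<gamma> e) \<and> {pathstart (\<gamma> e), pathfinish (\<gamma> e)} = p ` e) \<and>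
     (\<forall>e\<in>E. \<forall>v\<in>V. p v \<in> path_image (\<gamma> e) \<longrightarrow> v \<in> e) \<and>
     (\<forall>e\<in>E. \<forall>f\<in>E. e \<noteq> f \<longrightarrow> path_image (\<gamma> e) \<inter> path_image (\<gamma> f) \<subseteq> p ` (e \<inter> f))"

definition planar :: "'a set \<Rightarrow> 'a set set \<Rightarrow> bool" where
  "planar V E \<longleftrightarrow> (\<exists>p \<gamma>. planar_drawing V E p \<gamma>)"

definition union_of_planar_subgraphs :: "nat \<Rightarrow> 'a set \<Rightarrow> 'a set set \<Rightarrow> bool" where
  "union_of_planar_subgraphs t V E \<longleftrightarrow>
     (\<exists>W F. (\<forall>i<t. subgraph (W i) (F i) V E \<and> planar (W i) (F i)) \<and>
            (\<Union>i<t. W i) = V \<and> (\<Union>i<t. F i) = E)"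

(* On a finite simple graph the minimum exists: the single edges and single vertices
   are finitely many planar subgraphs covering the graph. *)
definition thickness :: "'a set \<Rightarrow> 'a set set \<Rightarrow> nat" where
  "thickness V E = (LEAST t. union_of_planar_subgraphs t V E)"

definition bar :: "real \<Rightarrow> real \<Rightarrow> real \<Rightarrow> (real \<times> real) set" where
  "bar l r y = closed_segment (l, y) (r, y)"

definition vertical_segment :: "(real \<times> real) set \<Rightarrow> bool" where
  "vertical_segment S \<longleftrightarrow> (\<exists>x a b. S = closed_segment (x, a) (x, b))"

(* B assigns to each vertex its bar, as a subset of the plane. *)
definition k_visible :: "nat \<Rightarrow> 'a set \<Rightarrow> ('a \<Rightarrow> (real \<times> real) set) \<Rightarrow> 'a \<Rightarrow> 'a \<Rightarrow> bool" where
  "k_visible k V B u v \<longleftrightarrow>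
     (\<exists>S. vertical_segment S \<and> S \<inter> B u \<noteq> {} \<and> S \<inter> B v \<noteq> {} \<and>
          card {w \<in> V - {u, v}. S \<inter> B w \<noteq> {}} \<le> k)"

(* The bar of v has endpoints (l v, y v) and (r v, y v). As bars are nonempty, pairwise
   disjointness makes the map from vertices to bars injective. *)
definition bar_visibility_rep ::
  "nat \<Rightarrow> 'a set \<Rightarrow> 'a set set \<Rightarrow> ('a \<Rightarrow> real) \<Rightarrow> ('a \<Rightarrow> real) \<Rightarrow> ('a \<Rightarrow> real) \<Rightarrow> bool" where
  "bar_visibility_rep k V E l r y \<longleftrightarrow>
     (\<forall>v\<in>V. l v < r v) \<and>
     (\<forall>u\<in>V. \<forall>v\<in>V. u \<noteq> v \<longrightarrow> bar (l u) (r u) (y u) \<inter> bar (l v) (r v) (y v) = {}) \<and>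
     (\<forall>u\<in>V. \<forall>v\<in>V. u \<noteq> v \<longrightarrow>
        ({u, v} \<in> E \<longleftrightarrow> k_visible k V (\<lambda>w. bar (l w) (r w) (y w)) u v))"

definition semi_bar_visibility_graph :: "nat \<Rightarrow> 'a set \<Rightarrow> 'a set set \<Rightarrow> bool" where
  "semi_bar_visibility_graph k V E \<longleftrightarrow>
     finite_simple_graph V E \<and>
     (\<exists>l r y. bar_visibility_rep k V E l r y \<and> (\<forall>v\<in>V. l v = 0))"

end

(* Order the bars by height. An edge of the graph has at most k blockers, that is, bars between
   its two ends that are at least as long as the shorter end. Edges without blockers do not
   cross if the vertices are put on a line in the order of heights. They form a graph in which a
   shortest bar has degree at most 2, and which therefore has a proper 3-colouring m. If an edge
   with a single blocker j gets the colour m j, then edges of the same colour do not cross, as two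
   crossing edges would have blockers that see each other. So the edges with at most one blocker
   fit into four pages, i.e. two planar graphs. For every i from 2 to k, the edges with exactly i
   blockers split into two forests, according to whether the shorter end is the upper or the lower
   one: a bar has at most one such edge going up, respectively down, to a bar at least as long. *)

theory Submission
  imports Defs
begin

section \<open>Two-page book drawings\<close>

text \<open>The condition for one page of a book: with the vertices at positions \<open>p\<close> on
  the spine, edges with alternating ends cannot be drawn on the same side. Ranging over all four
  vertices covers both orientations of each edge.\<close>

definition noncrossing :: "('a \<Rightarrow> real) \<Rightarrow> 'a set set \<Rightarrow> bool" where
  "noncrossing p E \<longleftrightarrow>
     (\<forall>a b c d. {a, c} \<in> E \<longrightarrow> {b, d} \<in> E \<longrightarrow> \<not> (p a < p b \<and> p b < p c \<and> p c < p d))"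

lemma noncrossingD:
  assumes "noncrossing p E" "{a, c} \<in> E" "{b, d} \<in> E"
  shows "\<not> (p a < p b \<and> p b < p c \<and> p c < p d)"
  using assms unfolding noncrossing_def by blast

lemma simple_graph_edgeD:
  assumes "simple_graph V E" "{u, v} \<in> E"
  shows "u \<noteq> v" "u \<in> V" "v \<in> V"
  using assms unfolding simple_graph_def by fastforce+

lemma simple_graph_orderedE:
  fixes p :: "'a \<Rightarrow> real"
  assumes "simple_graph V E" "inj_on p V" "e \<in> E"
  obtains u v where "e = {u, v}" "u \<in> V" "v \<in> V" "p u < p v"
proof -
  have e: "e \<subseteq> V" "card e = 2"
    using assms(1,3) by (auto simp: simple_graph_def)
  then obtain x y where xy: "e = {x, y}" "x \<noteq> y"
    by (auto simp: card_2_iff)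
  then have "p x \<noteq> p y"
    using e(1) assms(2) by (auto dest: inj_onD)
  then consider "p x < p y" | "p y < p x"
    by linarith
  then show thesis
    using that xy e(1) by cases (auto simp: insert_commute)
qed

text \<open>The sign of \<open>s\<close> picks the side of the axis. Parabolas serve as page arcs
  because nested ones compare factor by factor, without the square roots of semicircles.\<close>

definition parabola :: "real \<Rightarrow> real \<Rightarrow> real \<Rightarrow> real \<Rightarrow> real \<times> real" where
  "parabola s a b t = (let x = a + t * (b - a) in (x, s * ((x - a) * (b - x))))"

lemma path_image_parabola:
  assumes "a < b"
  shows "path_image (parabola s a b) = {(x, s * ((x - a) * (b - x))) |x. a \<le> x \<and> x \<le> b}"
proof -
  have "\<exists>t\<in>{0..1}. x = a + t * (b - a)" if "a \<le> x" "x \<le> b" for x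
    using that assms by (intro bexI[of _ "(x - a) / (b - a)"]) auto
  moreover have "a \<le> a + t * (b - a) \<and> a + t * (b - a) \<le> b" if "0 \<le> t" "t \<le> 1" for t
  proof -
    have "0 \<le> t * (b - a)" "t * (b - a) \<le> b - a"
      using that assms by (auto intro: mult_left_le_one_le)
    then show ?thesis
      by linarith
  qed
  ultimately show ?thesis
    unfolding path_image_def parabola_def Let_def by fastforce
qed

lemma arc_parabola:
  assumes "a < b"
  shows "arc (parabola s a b)"
proof -
  have "path (parabola s a b)"
    unfolding path_def parabola_def Let_def by (intro continuous_intros)
  moreover have "inj_on (parabola s a b) {0..1}"
    using assms by (auto simp: inj_on_def parabola_def Let_def)
  ultimately show ?thesis
    by (simp add: arc_def)
qed

text \<open>Both factors are positive and can only grow when the interval is enlarged, one of them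
  strictly. Hence arcs of nested edges on one page do not meet over the interior of the inner
  one.\<close>

lemma nested_parabola_less:
  fixes a b c d x :: real
  assumes "a \<le> c" "d \<le> b" "a < c \<or> d < b" "c < x" "x < d"
  shows "(x - c) * (d - x) < (x - a) * (b - x)"
proof (cases "a < c")
  case True
  then have "(x - c) * (d - x) < (x - a) * (d - x)"
    using assms by simp
  also have "\<dots> \<le> (x - a) * (b - x)"
    using assms by (intro mult_left_mono) auto
  finally show ?thesis .
next
  case False
  then have "(x - c) * (d - x) < (x - c) * (b - x)"
    using assms by simp
  also have "\<dots> \<le> (x - a) * (b - x)"
    using assms by (intro mult_right_mono) auto
  finally show ?thesis .
qed

text \<open>The vertices lie on the \<open>x\<close>-axis; edges of one page are drawn as parabolas above the axis,
  those of the other page below it.\<close>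

lemma planar_two_page_book:
  fixes p :: "'a \<Rightarrow> real"
  assumes E: "simple_graph V E" and inj: "inj_on p V"
    and nc: "noncrossing p {e \<in> E. page e}" "noncrossing p {e \<in> E. \<not> page e}"
  shows "planar V E"
proof -
  define s where "s e = (if page e then 1 else -1 :: real)" for e
  \<comment> \<open>An edge is an unordered set; \<open>Min\<close> and \<open>Max\<close> recover
    its left and right end.\<close>
  define \<gamma> where "\<gamma> e = parabola (s e) (Min (p ` e)) (Max (p ` e))" for e
  have s0: "s e \<noteq> 0" for e
    by (simp add: s_def)
  have \<gamma>: "\<gamma> {u, v} = parabola (s {u, v}) (p u) (p v)" if "p u < p v" for u v
    using that by (simp add: \<gamma>_def)
  have im: "path_image (\<gamma> {u, v}) = {(x, s {u, v} * ((x - p u) * (p v - x))) |x. p u \<le> x \<and> x \<le> p v}"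
    if "p u < p v" for u v
    using that by (simp add: \<gamma> path_image_parabola)
  have cross: "\<not> (p a < p b \<and> p b < p c \<and> p c < p d)"
    if "{a, c} \<in> E" "{b, d} \<in> E" "s {a, c} = s {b, d}" for a b c d
  proof (cases "page {a, c}")
    case True
    then have "page {b, d}"
      using that(3) by (simp add: s_def split: if_splits)
    with True show ?thesis
      using that by (intro noncrossingD[OF nc(1)]) simp_all
  next
    case False
    then have "\<not> page {b, d}"
      using that(3) by (simp add: s_def split: if_splits)
    with False show ?thesis
      using that by (intro noncrossingD[OF nc(2)]) simp_all
  qed
  have "planar_drawing V E (\<lambda>v. (p v, 0)) \<gamma>"
    unfolding planar_drawing_def
  proof (intro conjI ballI impI)
    show "inj_on (\<lambda>v. (p v, 0::real)) V"
      using inj by (auto simp: inj_on_def)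
  next
    fix e assume "e \<in> E"
    then obtain u v where uv: "e = {u, v}" "u \<in> V" "v \<in> V" "p u < p v"
      by (rule simple_graph_orderedE[OF E inj])
    show "arc (\<gamma> e)"
      using uv by (simp add: \<gamma> arc_parabola)
    show "{pathstart (\<gamma> e), pathfinish (\<gamma> e)} = (\<lambda>v. (p v, 0)) ` e"
      using uv by (auto simp: \<gamma> parabola_def pathstart_def pathfinish_def)
  next
    fix e w assume ew: "e \<in> E" "w \<in> V" "(p w, 0) \<in> path_image (\<gamma> e)"
    obtain u v where uv: "e = {u, v}" "u \<in> V" "v \<in> V" "p u < p v"
      using ew(1) by (rule simple_graph_orderedE[OF E inj])
    then have "p w = p u \<or> p w = p v"
      using ew(3) s0 by (auto simp: im)
    then show "w \<in> e"
      using inj uv ew(2) by (auto dest: inj_onD)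
  next
    fix e f assume ef: "e \<in> E" "f \<in> E" "e \<noteq> f"
    obtain a b where ab: "e = {a, b}" "a \<in> V" "b \<in> V" "p a < p b"
      by (rule simple_graph_orderedE[OF E inj ef(1)])
    obtain c d where cd: "f = {c, d}" "c \<in> V" "d \<in> V" "p c < p d"
      by (rule simple_graph_orderedE[OF E inj ef(2)])
    show "path_image (\<gamma> e) \<inter> path_image (\<gamma> f) \<subseteq> (\<lambda>v. (p v, 0)) ` (e \<inter> f)"
    proof
      fix q assume "q \<in> path_image (\<gamma> e) \<inter> path_image (\<gamma> f)"
      then obtain x where q: "q = (x, s e * ((x - p a) * (p b - x)))"
        and x: "p a \<le> x" "x \<le> p b" "p c \<le> x" "x \<le> p d"
        and eq: "s e * ((x - p a) * (p b - x)) = s f * ((x - p c) * (p d - x))"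
        using ab cd by (auto simp: im)
      show "q \<in> (\<lambda>v. (p v, 0)) ` (e \<inter> f)"
      \<comment> \<open>A common point on the axis is an end of both edges. Off the axis, the sign
        of the height fixes the page, so both edges lie on one page. Their intervals overlap without
        alternating, so they are nested, and nested arcs do not meet.\<close>
      proof (cases "x = p a \<or> x = p b")
        case True
        then have "x = p c \<or> x = p d"
          using eq s0 by auto
        with True have "x \<in> p ` e" "x \<in> p ` f"
          using ab cd by auto
        then obtain v w where "v \<in> e" "w \<in> f" "p v = x" "p w = x"
          unfolding image_iff by metis
        moreover from this have "v = w"
          using inj ab cd by (auto dest: inj_onD)
        ultimately show ?thesis
          using True q by auto
      next
        case False
        then have pos: "0 < (x - p a) * (p b - x)"
          using x by auto
        then have "x \<noteq> p c" "x \<noteq> p d"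
          using eq s0[of e] by auto
        then have x': "p a < x" "x < p b" "p c < x" "x < p d"
          using False x by auto
        then have "0 < (x - p c) * (p d - x)"
          by simp
        with pos eq have se: "s e = s f"
          by (auto simp: s_def split: if_splits)
        with eq have eq': "(x - p a) * (p b - x) = (x - p c) * (p d - x)"
          using s0 by auto
        have ne: "\<not> (p a = p c \<and> p b = p d)"
          using ef(3) ab cd inj by (auto dest: inj_onD)
        have "\<not> (p a < p c \<and> p b < p d)" "\<not> (p c < p a \<and> p d < p b)"
          using cross[of a b c d] cross[of c d a b] se ef ab(1) cd(1) x' by auto
        then consider "p a \<le> p c" "p d \<le> p b" | "p c \<le> p a" "p b \<le> p d"
          by linarith
        then have False
        proof cases
          case 1
          then show ?thesis
            using nested_parabola_less[of "p a" "p c" "p d" "p b" x] ne x' eq' by auto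
        next
          case 2
          then show ?thesis
            using nested_parabola_less[of "p c" "p a" "p b" "p d" x] ne x' eq' by auto
        qed
        then show ?thesis ..
      qed
    qed
  qed
  then show ?thesis
    unfolding planar_def by blast
qed

section \<open>Planarity of forests\<close>

text \<open>Inserting the vertices by increasing \<open>y\<close> adds an isolated vertex or a leaf
  each time, so the graph is a forest. The induction builds a spine order \<open>p\<close>, in
  general different from \<open>y\<close>, for which one page suffices.\<close>

lemma planar_if_unique_lower_neighbour:
  fixes y :: "'a \<Rightarrow> real"
  assumes fin: "finite V" and E: "simple_graph V E" and inj: "inj_on y V"
    and unique: "\<And>u v w. {u, v} \<in> E \<Longrightarrow> {u, w} \<in> E \<Longrightarrow> y v < y u \<Longrightarrow> y w < y u \<Longrightarrow> v = w"
  shows "planar V E"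
proof -
  note edge = simple_graph_edgeD(1)[OF E]
  have "S \<subseteq> V \<Longrightarrow> \<exists>p :: 'a \<Rightarrow> real. inj_on p S \<and> noncrossing p {e \<in> E. e \<subseteq> S}" if "finite S" for S
    using that
  proof (induction S rule: finite_ranking_induct[where f = y])
    case empty
    then show ?case
      by (auto simp: noncrossing_def)
  next
    case (insert x S)
    show ?case
    proof (cases "x \<in> S")
      case True
      then show ?thesis
        using insert by (simp add: insert_absorb)
    next
      case False
      obtain p :: "'a \<Rightarrow> real" where p: "inj_on p S" "noncrossing p {e \<in> E. e \<subseteq> S}"
        using insert by auto
      have lower: "y v < y x" if "v \<in> S" for v
        using insert.hyps(2)[OF that] inj insert.prems that False
        by (metis inj_onD insert_subset less_eq_real_def subsetD)
      text \<open>A leaf is placed immediately to the right of its neighbour.\<close>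
      have "\<exists>h. h \<notin> p ` S \<and>
          (\<forall>z\<in>S. {x, z} \<in> E \<longrightarrow> p z < h \<and> (\<forall>v\<in>S. \<not> (p z < p v \<and> p v < h)))"
      proof (cases "\<exists>z\<in>S. {x, z} \<in> E")
        case True
        then obtain z where z: "z \<in> S" "{x, z} \<in> E"
          by blast
        have only: "v = z" if "v \<in> S" "{x, v} \<in> E" for v
          using unique[OF that(2) z(2)] lower that(1) z(1) by auto
        \<comment> \<open>The extra element \<open>p z + 1\<close> keeps \<open>A\<close> nonempty
          when \<open>z\<close> is rightmost; the midpoint \<open>h\<close> then precedes every
          position to the right of \<open>z\<close>.\<close>
        define A where "A = insert (p z + 1) {t \<in> p ` S. p z < t}"
        have A: "finite A" "A \<noteq> {}"
          using insert.hyps by (auto simp: A_def)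
        then have min: "p z < Min A"
          by (auto simp: A_def)
        have A_le: "Min A \<le> p v" if "v \<in> S" "p z < p v" for v
          using that A by (intro Min_le) (auto simp: A_def)
        define h where "h = (p z + Min A) / 2"
        have h: "p z < h" "h < Min A"
          using min by (auto simp: h_def)
        have gap: "p v \<noteq> h" "\<not> (p z < p v \<and> p v < h)" if "v \<in> S" for v
          using A_le[OF that] h by (cases "p z < p v"; auto)+
        show ?thesis
        proof (intro exI[of _ h] conjI ballI impI)
          show "h \<notin> p ` S"
            using gap(1) by auto
          fix v assume "v \<in> S" "{x, v} \<in> E"
          then have v: "v = z"
            by (rule only)
          show "p v < h"
            using h(1) v by simp
          fix w assume "w \<in> S"
          then show "\<not> (p v < p w \<and> p w < h)"
            using gap(2) v by simp
        qed
      next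
        case False
        then show ?thesis
          using ex_new_if_finite[OF infinite_UNIV_char_0, of "p ` S"] insert.hyps by auto
      qed
      then obtain h where h: "h \<notin> p ` S"
        "\<And>z v. z \<in> S \<Longrightarrow> {x, z} \<in> E \<Longrightarrow> p z < h"
        "\<And>z v. z \<in> S \<Longrightarrow> {x, z} \<in> E \<Longrightarrow> v \<in> S \<Longrightarrow> \<not> (p z < p v \<and> p v < h)"
        by blast
      let ?p = "p(x := h)"
      have "inj_on ?p (insert x S)"
        using p(1) h(1) False by (auto simp: inj_on_def)
      moreover have "noncrossing ?p {e \<in> E. e \<subseteq> insert x S}"
        unfolding noncrossing_def
      proof (intro allI impI notI)
        fix a b c d
        assume "{a, c} \<in> {e \<in> E. e \<subseteq> insert x S}" "{b, d} \<in> {e \<in> E. e \<subseteq> insert x S}"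
        then have ac: "{a, c} \<in> E" "a \<in> insert x S" "c \<in> insert x S"
          and bd: "{b, d} \<in> E" "b \<in> insert x S" "d \<in> insert x S"
          by auto
        assume lt: "?p a < ?p b \<and> ?p b < ?p c \<and> ?p c < ?p d"
        \<comment> \<open>As a left end, \<open>x\<close> would have its neighbour to the right, but
          \<open>h\<close> lies to the right of it. As a right end, \<open>x\<close> would have an
          end of the other edge strictly between its neighbour and itself.\<close>
        consider "a = x" | "b = x" | "c = x" | "d = x" | "x \<notin> {a, b, c, d}"
          by blast
        then show False
        proof cases
          case 1
          then have "{x, c} \<in> E" "c \<in> S"
            using ac lt edge by auto
          from h(2)[OF this(2,1)] show ?thesis
            using 1 lt \<open>c \<in> S\<close> False by (auto split: if_splits)
        next
          case 2
          then have "{x, d} \<in> E" "d \<in> S"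
            using bd lt edge by auto
          from h(2)[OF this(2,1)] show ?thesis
            using 2 lt \<open>d \<in> S\<close> False by (auto split: if_splits)
        next
          case 3
          then have "{x, a} \<in> E" "a \<in> S" "b \<in> S"
            using ac bd lt edge by (auto simp: insert_commute)
          from h(3)[OF this(2,1,3)] show ?thesis
            using 3 lt \<open>a \<in> S\<close> \<open>b \<in> S\<close> False by (auto split: if_splits)
        next
          case 4
          then have "{x, b} \<in> E" "b \<in> S" "c \<in> S"
            using ac bd lt edge by (auto simp: insert_commute)
          from h(3)[OF this(2,1,3)] show ?thesis
            using 4 lt \<open>b \<in> S\<close> \<open>c \<in> S\<close> False by (auto split: if_splits)
        next
          case 5
          then have "{a, c} \<in> {e \<in> E. e \<subseteq> S}" "{b, d} \<in> {e \<in> E. e \<subseteq> S}"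
            using ac bd by auto
          moreover have "p a < p b \<and> p b < p c \<and> p c < p d"
            using lt 5 by auto
          ultimately show ?thesis
            using noncrossingD[OF p(2)] by blast
        qed
      qed
      ultimately show ?thesis
        by blast
    qed
  qed
  then obtain p :: "'a \<Rightarrow> real" where "inj_on p V" "noncrossing p {e \<in> E. e \<subseteq> V}"
    using fin by blast
  moreover have "{e \<in> E. e \<subseteq> V} = E"
    using E by (auto simp: simple_graph_def)
  \<comment> \<open>All edges go on one page; the other one stays empty.\<close>
  ultimately show ?thesis
    using E by (intro planar_two_page_book[where page = "\<lambda>_. True"]) (auto simp: noncrossing_def)
qed

section \<open>Three-colouring of the visibility graph\<close>

text \<open>A shortest bar sees at most its two neighbours in the vertical order, so it can be coloured
  last.\<close>

lemma visibility_3_colouring: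
  fixes y r :: "'a \<Rightarrow> real"
  assumes "finite V" "inj_on y V"
  shows "\<exists>m :: 'a \<Rightarrow> nat. (\<forall>v. m v < 3) \<and>
    (\<forall>u\<in>V. \<forall>v\<in>V. y u < y v \<longrightarrow>
      (\<forall>w\<in>V. y u < y w \<longrightarrow> y w < y v \<longrightarrow> r w < r u \<and> r w < r v) \<longrightarrow> m u \<noteq> m v)"
  using assms
\<comment> \<open>Ranking by \<open>- r\<close> inserts the bars by decreasing length, so
  \<open>x\<close> is a shortest bar of \<open>insert x S\<close>.\<close>
proof (induction V rule: finite_ranking_induct[where f = "\<lambda>v. - r v"])
  case empty
  then show ?case
    by (auto intro: exI[of _ "\<lambda>_. 0"])
next
  case (insert x S)
  show ?case
  proof (cases "x \<in> S")
    case True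
    then show ?thesis
      using insert by (simp add: insert_absorb)
  next
    case False
    have "inj_on y S"
      using insert.prems by simp
    then obtain m :: "'a \<Rightarrow> nat" where m3: "\<forall>v. m v < 3"
      and m: "\<forall>u\<in>S. \<forall>v\<in>S. y u < y v \<longrightarrow>
        (\<forall>w\<in>S. y u < y w \<longrightarrow> y w < y v \<longrightarrow> r w < r u \<and> r w < r v) \<longrightarrow> m u \<noteq> m v"
      using insert.IH by blast
    have inj: "u = v" if "u \<in> S" "v \<in> S" "y u = y v" for u v
      using insert.prems that by (auto dest: inj_onD)
    \<comment> \<open>Only the nearest bars below and above can constrain the colour of
      \<open>x\<close>: beyond them, the view is blocked by a bar at least as long as
      \<open>x\<close>. If such a bar is missing, \<open>i\<close> or \<open>j\<close> is
      arbitrary.\<close>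
    define below where "below v \<longleftrightarrow> v \<in> S \<and> y v < y x \<and> (\<forall>w\<in>S. \<not> (y v < y w \<and> y w < y x))" for v
    define above where "above v \<longleftrightarrow> v \<in> S \<and> y x < y v \<and> (\<forall>w\<in>S. \<not> (y x < y w \<and> y w < y v))" for v
    have below: "u = v" if "below u" "below v" for u v
      using that inj[of u v] unfolding below_def by (meson linorder_neqE)
    have above: "u = v" if "above u" "above v" for u v
      using that inj[of u v] unfolding above_def by (meson linorder_neqE)
    obtain i where i: "\<And>v. below v \<Longrightarrow> m v = i"
      using below by metis
    obtain j where j: "\<And>v. above v \<Longrightarrow> m v = j"
      using above by metis
    have "\<exists>c\<in>{0, 1, 2}. c \<noteq> i \<and> c \<noteq> j"
      by auto
    then obtain c where "c \<in> {0, 1, 2}" and c_ne: "c \<noteq> i" "c \<noteq> j"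
      by blast
    then have c: "c < 3" "c \<noteq> i" "c \<noteq> j"
      by auto
    have low: "r x \<le> r v" if "v \<in> S" for v
      using insert.hyps(2)[OF that] by simp
    show ?thesis
    proof (intro exI[of _ "m(x := c)"] conjI allI ballI impI)
      fix v show "(m(x := c)) v < 3"
        using m3 c(1) by simp
    next
      fix u v
      assume uv: "u \<in> insert x S" "v \<in> insert x S" "y u < y v"
        and vis: "\<forall>w\<in>insert x S. y u < y w \<longrightarrow> y w < y v \<longrightarrow> r w < r u \<and> r w < r v"
      consider "u = x" "v \<in> S" | "v = x" "u \<in> S" | "u \<in> S" "v \<in> S"
        using uv by auto
      then show "(m(x := c)) u \<noteq> (m(x := c)) v"
      proof cases
        case 1
        then have "above v"
          using uv vis low unfolding above_def by fastforce
        then show ?thesis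
          using j c 1 False by auto
      next
        case 2
        then have "below u"
          using uv vis low unfolding below_def by fastforce
        then show ?thesis
          using i c 2 False by auto
      next
        \<comment> \<open>Seeing each other in \<open>insert x S\<close> implies seeing each other
          in \<open>S\<close>, which has fewer bars in between.\<close>
        case 3
        then show ?thesis
          using m uv vis False by (metis fun_upd_other insertCI)
      qed
    qed
  qed
qed

section \<open>Blockers and classes of edges by their number\<close>

text \<open>All semi-bars start at the same abscissa, so every vertical segment meeting both ends of
  \<open>e\<close> also meets its blockers. Quantifying over \<open>e\<close> avoids orienting the
  edge and makes the set invariant under reflection of the heights.\<close>

definition blockers :: "'a set \<Rightarrow> ('a \<Rightarrow> real) \<Rightarrow> ('a \<Rightarrow> real) \<Rightarrow> 'a set \<Rightarrow> 'a set" where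
  "blockers V y r e =
     {w \<in> V. (\<exists>u\<in>e. y u < y w) \<and> (\<exists>u\<in>e. y w < y u) \<and> (\<exists>u\<in>e. r u \<le> r w)}"

lemma blockers_pair:
  assumes "y u < y v"
  shows "blockers V y r {u, v} = {w \<in> V. y u < y w \<and> y w < y v \<and> (r u \<le> r w \<or> r v \<le> r w)}"
  using assms by (auto simp: blockers_def)

lemma finite_blockers: "finite V \<Longrightarrow> finite (blockers V y r e)"
  by (simp add: blockers_def)

text \<open>In a crossing, \<open>b\<close> not blocking \<open>{a, c}\<close> forces
  \<open>r b < r c\<close>, while \<open>c\<close> not blocking \<open>{b, d}\<close> forces
  \<open>r c < r b\<close>.\<close>

lemma noncrossing_no_blockers:
  assumes "simple_graph V E" "\<And>e. e \<in> E \<Longrightarrow> blockers V y r e = {}"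
  shows "noncrossing y E"
  unfolding noncrossing_def
proof (intro allI impI notI)
  fix a b c d
  assume e: "{a, c} \<in> E" "{b, d} \<in> E" and lt: "y a < y b \<and> y b < y c \<and> y c < y d"
  then have "b \<in> V" "c \<in> V"
    using simple_graph_edgeD[OF assms(1)] by metis+
  moreover have "b \<notin> blockers V y r {a, c}" "c \<notin> blockers V y r {b, d}"
    using assms(2) e by auto
  ultimately show False
    using lt by (auto simp: blockers_pair)
qed

text \<open>If two edges with one blocker each cross, then their blockers see each other.\<close>

lemma noncrossing_one_blocker:
  fixes y r :: "'a \<Rightarrow> real"
  assumes E: "simple_graph V E"
    and m: "\<And>u v. u \<in> V \<Longrightarrow> v \<in> V \<Longrightarrow> y u < y v \<Longrightarrow>
      \<forall>w\<in>V. y u < y w \<longrightarrow> y w < y v \<longrightarrow> r w < r u \<and> r w < r v \<Longrightarrow> m u \<noteq> m v"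
    and one: "\<And>e. e \<in> E \<Longrightarrow> \<exists>j. blockers V y r e = {j} \<and> m j = i"
  shows "noncrossing y E"
  unfolding noncrossing_def
proof (intro allI impI notI)
  fix a b c d
  assume e: "{a, c} \<in> E" "{b, d} \<in> E" and lt: "y a < y b \<and> y b < y c \<and> y c < y d"
  then have V: "b \<in> V" "c \<in> V"
    using simple_graph_edgeD[OF E] by metis+
  obtain j where j: "blockers V y r {a, c} = {j}" "m j = i"
    using one e by blast
  obtain j' where j': "blockers V y r {b, d} = {j'}" "m j' = i"
    using one e by blast
  have J: "w = j \<longleftrightarrow> w \<in> V \<and> y a < y w \<and> y w < y c \<and> (r a \<le> r w \<or> r c \<le> r w)" for w
    using j(1) lt by (subst (asm) blockers_pair) auto
  have J': "w = j' \<longleftrightarrow> w \<in> V \<and> y b < y w \<and> y w < y d \<and> (r b \<le> r w \<or> r d \<le> r w)" for w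
    using j'(1) lt by (subst (asm) blockers_pair) auto
  note Jj = J[of j, simplified] and Jj' = J'[of j', simplified]
  \<comment> \<open>By \<open>m\<close>, blockers with only shorter bars between them have different
    colours, but \<open>j\<close> and \<open>j'\<close> both have colour \<open>i\<close>.\<close>
  have sees: False if "y j < y j'" "\<And>w. w \<in> V \<Longrightarrow> y j < y w \<Longrightarrow> y w < y j' \<Longrightarrow> r w < r j \<and> r w < r j'"
    using m[of j j'] that Jj Jj' j(2) j'(2) by auto
  show False
  \<comment> \<open>Either \<open>b\<close> is the blocker of \<open>{a, c}\<close>, or
    \<open>b\<close> is shorter than \<open>c\<close> and then \<open>c\<close> is the blocker of
    \<open>{b, d}\<close>. In both cases a bar between \<open>j\<close> and \<open>j'\<close> lies
    inside an edge that it does not block, so it is short.\<close>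
  proof (cases "b = j")
    case bj: True
    show False
    proof (rule sees)
      show "y j < y j'"
        using bj Jj' by simp
      fix w assume w: "w \<in> V" "y j < y w" "y w < y j'"
      then have "w \<noteq> j'" "w \<noteq> j"
        by auto
      then have wb: "r w < r b" "r w < r d"
        using J'[of w] w bj Jj' by auto
      moreover have "r w < r j'"
        using wb Jj' by auto
      ultimately show "r w < r j \<and> r w < r j'"
        using bj by simp
    qed
  next
    case False
    then have b: "r b < r a" "r b < r c"
      using J[of b] V lt by auto
    then have cj: "c = j'"
      using J'[of c] V lt by auto
    show False
    proof (rule sees)
      show "y j < y j'"
        using cj Jj by simp
      fix w assume w: "w \<in> V" "y j < y w" "y w < y j'"
      then have "w \<noteq> j'" "w \<noteq> j"
        by auto
      then have "r w < r a" "r w < r c"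
        using J[of w] w cj Jj by auto
      then show "r w < r j \<and> r w < r j'"
        using cj Jj by auto
    qed
  qed
qed

text \<open>With \<open>u\<close> as a shorter end of both edges, every blocker of
  \<open>{u, v}\<close> also blocks \<open>{u, w}\<close>, and \<open>v\<close> itself is an
  additional blocker of \<open>{u, w}\<close>.\<close>

lemma card_blockers_strict_mono:
  assumes "finite V" "v \<in> V" "y u < y v" "y v < y w" "r u \<le> r v" "r u \<le> r w"
  shows "card (blockers V y r {u, v}) < card (blockers V y r {u, w})"
proof (rule psubset_card_mono)
  show "blockers V y r {u, v} \<subset> blockers V y r {u, w}"
    using assms by (auto simp: blockers_pair)
qed (use assms(1) in \<open>simp add: finite_blockers\<close>)

lemma blockers_uminus: "blockers V (\<lambda>v. - y v) r e = blockers V y r e"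
  by (auto simp: blockers_def)

text \<open>Edges going down from the same upper, shorter end to different bars have different
  numbers of blockers. Fixing the number therefore leaves each bar at most one lower neighbour,
  which gives a forest.\<close>

lemma planar_shorter_end_above:
  fixes y r :: "'a \<Rightarrow> real"
  assumes fin: "finite V" and E: "simple_graph V E" and inj: "inj_on y V"
    and lev: "\<And>e. e \<in> E \<Longrightarrow> card (blockers V y r e) = n"
    and short: "\<And>u v. {u, v} \<in> E \<Longrightarrow> y v < y u \<Longrightarrow> r u \<le> r v"
  shows "planar V E"
proof (rule planar_if_unique_lower_neighbour[OF fin E inj])
  have mono: "\<not> y v < y w"
    if "{u, v} \<in> E" "{u, w} \<in> E" "y v < y u" "y w < y u" for u v w
  proof
    assume "y v < y w"
    moreover have "w \<in> V"
      using simple_graph_edgeD(3)[OF E] that by metis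
    \<comment> \<open>Reflecting the heights turns these downward edges into upward ones, as strict
      monotonicity requires.\<close>
    ultimately have "card (blockers V (\<lambda>v. - y v) r {u, w}) < card (blockers V (\<lambda>v. - y v) r {u, v})"
      using that short fin by (intro card_blockers_strict_mono) auto
    then show False
      using lev that by (simp add: blockers_uminus)
  qed
  fix u v w assume uvw: "{u, v} \<in> E" "{u, w} \<in> E" "y v < y u" "y w < y u"
  then have "y v = y w"
    using mono[of u v w] mono[of u w v] by auto
  moreover have "v \<in> V" "w \<in> V"
    using simple_graph_edgeD(3)[OF E] uvw by metis+
  ultimately show "v = w"
    using inj by (auto dest: inj_onD)
qed

section \<open>Geometry of semi-bar representations\<close>

text \<open>The abscissa of a segment witnessing visibility is at most the length of either end,
  hence at most that of each blocker. The segment spans all heights between the ends, so the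
  blockers are among the at most \<open>k\<close> other bars met.\<close>

lemma card_blockers_le:
  assumes rep: "bar_visibility_rep k V E l r y" and l: "\<forall>v\<in>V. l v = 0" and fin: "finite V"
    and e: "{u, v} \<in> E" "u \<in> V" "v \<in> V" "u \<noteq> v"
  shows "card (blockers V y r {u, v}) \<le> k"
proof -
  have bar: "bar (l w) (r w) (y w) = {0..r w} \<times> {y w}" if "w \<in> V" for w
  proof -
    have "l w = 0"
      using l that by (rule bspec)
    moreover have "l w < r w"
      using rep[unfolded bar_visibility_rep_def, THEN conjunct1] that by (rule bspec)
    ultimately have "l w = 0" "0 < r w"
      by auto
    then show ?thesis
      by (auto simp: bar_def closed_segment_same_snd closed_segment_eq_real_ivl)
  qed
  have "k_visible k V (\<lambda>w. bar (l w) (r w) (y w)) u v"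
    using rep[unfolded bar_visibility_rep_def, THEN conjunct2, THEN conjunct2] e by simp
  then obtain x a b where S: "closed_segment (x, a) (x, b) \<inter> bar (l u) (r u) (y u) \<noteq> {}"
      "closed_segment (x, a) (x, b) \<inter> bar (l v) (r v) (y v) \<noteq> {}"
    and k: "card {w \<in> V - {u, v}. closed_segment (x, a) (x, b) \<inter> bar (l w) (r w) (y w) \<noteq> {}} \<le> k"
      (is "card ?B \<le> k")
    unfolding k_visible_def vertical_segment_def by blast
  have seg: "closed_segment (x, a) (x, b) = {x} \<times> {min a b..max a b}"
    by (auto simp: closed_segment_same_fst closed_segment_eq_real_ivl)
  have x: "0 \<le> x" "x \<le> r u" "x \<le> r v" "y u \<in> {min a b..max a b}" "y v \<in> {min a b..max a b}"
    using S unfolding seg bar[OF e(2)] bar[OF e(3)] by auto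
  have "blockers V y r {u, v} \<subseteq> ?B"
  proof
    fix w assume w: "w \<in> blockers V y r {u, v}"
    then have "w \<in> V" "x \<le> r w" "y w \<in> {min a b..max a b}" "w \<noteq> u" "w \<noteq> v"
      using x by (auto simp: blockers_def)
    moreover from this have "(x, y w) \<in> closed_segment (x, a) (x, b) \<inter> bar (l w) (r w) (y w)"
      unfolding seg bar[OF \<open>w \<in> V\<close>] using x(1) by simp
    ultimately show "w \<in> ?B"
      by blast
  qed
  then have "card (blockers V y r {u, v}) \<le> card ?B"
    using fin by (intro card_mono) auto
  with k show ?thesis
    by simp
qed

text \<open>Bars of equal height would share their left endpoint.\<close>

lemma semi_bar_heights_inj:
  assumes "bar_visibility_rep k V E l r y" "\<forall>v\<in>V. l v = 0"
  shows "inj_on y V"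
proof (rule inj_onI, rule ccontr)
  fix u v assume uv: "u \<in> V" "v \<in> V" "y u = y v" "u \<noteq> v"
  then have "bar (l u) (r u) (y u) \<inter> bar (l v) (r v) (y v) = {}"
    using assms unfolding bar_visibility_rep_def by blast
  moreover have "(0, y u) \<in> bar (l u) (r u) (y u)" "(0, y v) \<in> bar (l v) (r v) (y v)"
    using assms uv by (auto simp: bar_def)
  ultimately show False
    using uv by auto
qed

section \<open>Covering the graph by \<open>2 * k\<close> planar subgraphs\<close>

theorem theorem6:
  fixes k :: nat and V :: "'a set" and E :: "'a set set"
  assumes "k \<ge> 1"
    and "semi_bar_visibility_graph k V E"
  shows "thickness V E \<le> 2 * k"
proof -
  obtain l r y where fin: "finite V" and E: "simple_graph V E"
    and rep: "bar_visibility_rep k V E l r y" and l: "\<forall>v\<in>V. l v = 0"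
    using assms(2) unfolding semi_bar_visibility_graph_def finite_simple_graph_def by blast
  have inj: "inj_on y V"
    using semi_bar_heights_inj[OF rep l] .
  have sub: "simple_graph V F" if "F \<subseteq> E" for F
    using E that by (auto simp: simple_graph_def)
  obtain m :: "'a \<Rightarrow> nat" where m3: "\<And>v. m v < 3"
    and m: "\<And>u v. u \<in> V \<Longrightarrow> v \<in> V \<Longrightarrow> y u < y v \<Longrightarrow>
      \<forall>w\<in>V. y u < y w \<longrightarrow> y w < y v \<longrightarrow> r w < r u \<and> r w < r v \<Longrightarrow> m u \<noteq> m v"
    using visibility_3_colouring[OF fin inj, of r] by blast
  define B where "B = blockers V y r"
  define C where "C i = {e \<in> E. \<exists>j. B e = {j} \<and> m j = i}" for i
  define D where "D n = {e \<in> E. card (B e) = n}" for n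
  \<comment> \<open>Edges with ends of equal length count as \<open>up\<close>; in all others of the
    remaining class the lower end is strictly shorter.\<close>
  define up where "up e \<longleftrightarrow> (\<forall>u\<in>e. \<forall>v\<in>e. y v < y u \<longrightarrow> r u \<le> r v)" for e
  have B_fin: "finite (B e)" for e
    using fin by (simp add: B_def finite_blockers)
  have DE: "D n \<subseteq> E" and CE: "C i \<subseteq> E" for n i
    by (auto simp: D_def C_def)
  have nc0: "noncrossing y (D 0)"
    using B_fin
    by (intro noncrossing_no_blockers[where V = V and r = r, OF sub[OF DE]]) (auto simp: D_def B_def)
  have ncC: "noncrossing y (C i)" for i
    using sub[OF CE] m by (intro noncrossing_one_blocker[where V = V and r = r and m = m and i = i])
      (auto simp: C_def B_def)
  have C_disj: "C i \<inter> C j = {}" if "i \<noteq> j" for i j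
    using that by (auto simp: C_def)
  have CD_disj: "D 0 \<inter> C i = {}" for i
    by (auto simp: C_def D_def)
  \<comment> \<open>\<open>D 0\<close> takes the upper page and \<open>C 0\<close> the lower
    one.\<close>
  have pl0: "planar V (D 0 \<union> C 0)"
  proof (rule planar_two_page_book[OF _ inj])
    show "simple_graph V (D 0 \<union> C 0)"
      by (intro sub) (use DE CE in blast)
    have "{e \<in> D 0 \<union> C 0. e \<in> D 0} = D 0" "{e \<in> D 0 \<union> C 0. e \<notin> D 0} = C 0"
      using CD_disj by auto
    then show "noncrossing y {e \<in> D 0 \<union> C 0. e \<in> D 0}" "noncrossing y {e \<in> D 0 \<union> C 0. e \<notin> D 0}"
      using nc0 ncC by simp_all
  qed
  have pl1: "planar V (C 1 \<union> C 2)"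
  proof (rule planar_two_page_book[OF _ inj])
    show "simple_graph V (C 1 \<union> C 2)"
      by (intro sub) (use CE in blast)
    have "{e \<in> C 1 \<union> C 2. e \<in> C 1} = C 1" "{e \<in> C 1 \<union> C 2. e \<notin> C 1} = C 2"
      using C_disj[of 1 2] by auto
    then show "noncrossing y {e \<in> C 1 \<union> C 2. e \<in> C 1}" "noncrossing y {e \<in> C 1 \<union> C 2. e \<notin> C 1}"
      using ncC by simp_all
  qed
  have pl_up: "planar V {e \<in> D n. up e}" for n
    by (rule planar_shorter_end_above[OF fin _ inj, where r = r and n = n])
      (auto simp: D_def B_def up_def intro!: sub)
  \<comment> \<open>Reflection makes the lower, shorter end the upper one.\<close>
  have pl_down: "planar V {e \<in> D n. \<not> up e}" for n
  proof (rule planar_shorter_end_above[OF fin, where r = r and n = n and y = "\<lambda>v. - y v"])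
    show "inj_on (\<lambda>v. - y v) V"
      using inj by (auto simp: inj_on_def)
    show "simple_graph V {e \<in> D n. \<not> up e}"
      by (intro sub) (use DE in blast)
  qed (auto simp: D_def B_def up_def blockers_uminus)
  \<comment> \<open>From \<open>i = 2\<close> on, the parity of \<open>i\<close> separates the two
    forests and \<open>i div 2 + 1\<close> is the number of blockers: 2 for \<open>i = 2, 3\<close>,
    up to \<open>k\<close> for the last index \<open>2 * k - 1\<close>.\<close>
  define F where "F i = (if i = 0 then D 0 \<union> C 0 else if i = 1 then C 1 \<union> C 2
    else if even i then {e \<in> D (i div 2 + 1). up e} else {e \<in> D (i div 2 + 1). \<not> up e})" for i :: nat
  have FE: "F i \<subseteq> E" for i
    using DE CE by (auto simp: F_def)
  have pl: "planar V (F i)" for i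
    using pl0 pl1 pl_up pl_down by (simp add: F_def)
  have "\<exists>i<2 * k. e \<in> F i" if e: "e \<in> E" for e
  proof -
    obtain u v where uv: "e = {u, v}" "u \<in> V" "v \<in> V" "y u < y v"
      by (rule simple_graph_orderedE[OF E inj e])
    then have k: "card (B e) \<le> k"
      using card_blockers_le[OF rep l fin, of u v] e by (auto simp: B_def)
    consider "card (B e) = 0" | "card (B e) = 1" | "2 \<le> card (B e)"
      by linarith
    then show ?thesis
    proof cases
      case 1
      then show ?thesis
        using assms(1) e by (intro exI[of _ 0]) (auto simp: F_def D_def)
    next
      case 2
      then obtain j where "B e = {j}"
        by (auto simp: card_1_singleton_iff)
      then have "e \<in> C (m j)"
        using e by (auto simp: C_def)
      moreover have "m j = 0 \<or> m j = 1 \<or> m j = 2"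
        using m3[of j] by linarith
      ultimately have "e \<in> F 0 \<or> e \<in> F 1"
        by (auto simp: F_def)
      moreover have "0 < 2 * k" "1 < 2 * k"
        using assms(1) by auto
      ultimately show ?thesis
        by blast
    next
      case 3
      define i where "i = 2 * (card (B e) - 1) + (if up e then 0 else 1)"
      have "i div 2 + 1 = card (B e)" "even i \<longleftrightarrow> up e" "2 \<le> i" "i < 2 * k"
        using 3 k by (auto simp: i_def)
      then show ?thesis
        using e by (intro exI[of _ i]) (auto simp: F_def D_def)
    qed
  qed
  then have "(\<Union>i<2 * k. F i) = E"
    using FE by blast
  \<comment> \<open>Since \<open>k \<ge> 1\<close>, the index set is nonempty.\<close>
  moreover have "(\<Union>i<2 * k. V) = V"
    using assms(1) by (simp add: lessThan_empty_iff bot_nat_def)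
  ultimately have "union_of_planar_subgraphs (2 * k) V E"
    unfolding union_of_planar_subgraphs_def subgraph_def
    using pl FE sub by (intro exI[of _ "\<lambda>_. V"] exI[of _ F]) auto
  then show ?thesis
    unfolding thickness_def by (rule Least_le)
qed

end
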